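(* Let $\varepsilon\in(0,1]$ and let $u^\varepsilon$ be a solution of $2\Delta^2u^\varepsilon=-\beta_\varepsilon(u^\varepsilon)$ in $\Omega$. Then, for any $\phi=(\phi^1,\dots,\phi^n)\in C_0^\infty(\Omega,\mathbb{R}^n)$, $$2\int_\Omega\Big(2\,\mathrm{tr}\big(D^2u^\varepsilon(y)\,D\phi(y)\big)+\nabla u^\varepsilon(y)\cdot\Delta\phi(y)\Big)\,\Delta u^\varepsilon(y)\,dy=\int_\Omega\mathrm{div}\,\phi(y)\,\Big(|\Delta u^\varepsilon(y)|^2+\mathcal B_\varepsilon\big(u^\varepsilon(y)\big)\Big)\,dy.$$
   Context: $\Omega\subset\mathbb{R}^n$ is a smooth and bounded domain. $\beta:\mathbb{R}\to[0,+\infty)$ is a smooth, nonnegative function with support contained in $[0,1]$ and $\int_{\mathbb{R}}\beta(t)\,dt=1$. For $\varepsilon\in(0,1]$, $\beta_\varepsilon(t):=\frac1\varepsilon\beta\left(\frac t\varepsilon\right)$ and $\mathcal B_\varepsilon(v):=\int_0^v\beta_\varepsilon(t)\,dt$. Solutions are understood to be bounded; $\Delta\phi$ denotes the componentwise Laplacian of the vector field $\phi$. *)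

theory Defs
  imports "HOL-Analysis.Analysis"
begin

definition partial_deriv ::
    "'a::euclidean_space \<Rightarrow> ('a \<Rightarrow> 'b::real_normed_vector) \<Rightarrow> 'a \<Rightarrow> 'b" where
  "partial_deriv b f x = frechet_derivative f (at x) b"

text \<open>Only used for open sets \<open>S\<close>: \<open>C_on k S f\<close> says that all partial derivatives of
  order up to \<open>k\<close> exist and are continuous on \<open>S\<close>; the values of \<open>f\<close> outside \<open>S\<close> are irrelevant.\<close>

fun C_on :: "nat \<Rightarrow> 'a::euclidean_space set \<Rightarrow> ('a \<Rightarrow> 'b::real_normed_vector) \<Rightarrow> bool" where
  "C_on 0 S f \<longleftrightarrow> continuous_on S f"
| "C_on (Suc k) S f \<longleftrightarrow>
     (\<forall>x\<in>S. f differentiable (at x)) \<and> (\<forall>b\<in>Basis. C_on k S (partial_deriv b f))"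

definition smooth_on :: "'a::euclidean_space set \<Rightarrow> ('a \<Rightarrow> 'b::real_normed_vector) \<Rightarrow> bool" where
  "smooth_on S f \<longleftrightarrow> (\<forall>k. C_on k S f)"

definition grad :: "(real^'n \<Rightarrow> real) \<Rightarrow> real^'n \<Rightarrow> real^'n" where
  "grad f x = (\<chi> i. partial_deriv (axis i 1) f x)"

definition hessian :: "(real^'n \<Rightarrow> real) \<Rightarrow> real^'n \<Rightarrow> real^'n^'n" where
  "hessian f x = jacobian (grad f) (at x)"

definition laplacian :: "(real^'n \<Rightarrow> real) \<Rightarrow> real^'n \<Rightarrow> real" where
  "laplacian f x = (\<Sum>i\<in>UNIV. partial_deriv (axis i 1) (partial_deriv (axis i 1) f) x)"

definition vec_laplacian :: "(real^'n \<Rightarrow> real^'m) \<Rightarrow> real^'n \<Rightarrow> real^'m" where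
  "vec_laplacian F x = (\<chi> k. laplacian (\<lambda>z. F z $ k) x)"

definition divergence :: "(real^'n \<Rightarrow> real^'n) \<Rightarrow> real^'n \<Rightarrow> real" where
  "divergence F x = (\<Sum>i\<in>UNIV. partial_deriv (axis i 1) (\<lambda>z. F z $ i) x)"

text \<open>The boundary is smooth if \<open>\<Omega>\<close> is, near each boundary point, the negativity set of a smooth
  function without critical points.\<close>

definition smooth_bounded_domain :: "(real^'n) set \<Rightarrow> bool" where
  "smooth_bounded_domain \<Omega> \<longleftrightarrow>
     open \<Omega> \<and> connected \<Omega> \<and> \<Omega> \<noteq> {} \<and> bounded \<Omega> \<and>
     (\<forall>p\<in>frontier \<Omega>. \<exists>U \<rho>. open U \<and> p \<in> U \<and> smooth_on U \<rho> \<and>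
        (\<forall>x\<in>U. grad \<rho> x \<noteq> 0) \<and> \<Omega> \<inter> U = {x\<in>U. \<rho> x < 0})"

text \<open>\<open>C_0\<^sup>\<infinity>(\<Omega>)\<close>: as usual, its members are extended by zero to the whole space.\<close>

definition test_field :: "(real^'n) set \<Rightarrow> (real^'n \<Rightarrow> real^'n) \<Rightarrow> bool" where
  "test_field \<Omega> \<phi> \<longleftrightarrow> smooth_on UNIV \<phi> \<and>
     compact (closure {x. \<phi> x \<noteq> 0}) \<and> closure {x. \<phi> x \<noteq> 0} \<subseteq> \<Omega>"

definition beta_eps :: "(real \<Rightarrow> real) \<Rightarrow> real \<Rightarrow> real \<Rightarrow> real" where
  "beta_eps \<beta> \<epsilon> t = 1 / \<epsilon> * \<beta> (t / \<epsilon>)"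

text \<open>The interval integral is oriented, so negative upper limits are covered as well.\<close>

definition B_eps :: "(real \<Rightarrow> real) \<Rightarrow> real \<Rightarrow> real \<Rightarrow> real" where
  "B_eps \<beta> \<epsilon> v = (LBINT t=ereal 0..ereal v. beta_eps \<beta> \<epsilon> t)"

text \<open>Bounded classical solutions of \<open>2 \<Delta>\<^sup>2 u = - \<beta>\<^sub>\<epsilon>(u)\<close> in \<open>\<Omega>\<close>; no regularity up to the
  boundary and no boundary condition is imposed.\<close>

definition bounded_solution ::
    "(real \<Rightarrow> real) \<Rightarrow> real \<Rightarrow> (real^'n) set \<Rightarrow> (real^'n \<Rightarrow> real) \<Rightarrow> bool" where
  "bounded_solution \<beta> \<epsilon> \<Omega> u \<longleftrightarrow>
     C_on 4 \<Omega> u \<and> bounded (u ` \<Omega>) \<and>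
     (\<forall>x\<in>\<Omega>. 2 * laplacian (laplacian u) x = - beta_eps \<beta> \<epsilon> (u x))"

end

theory Submission
  imports Defs
begin

text \<open>
  The identity is the equation tested with \<open>v = \<nabla>u \<bullet> \<phi>\<close>, the derivative of \<open>u\<close> under the domain
  variation generated by \<open>\<phi>\<close>. Write \<open>w = \<Delta>u\<close>. Since partial derivatives commute,
  \<open>\<Delta>v = \<nabla>w \<bullet> \<phi> + 2 tr (D\<^sup>2u D\<phi>) + \<nabla>u \<bullet> \<Delta>\<phi>\<close> (lemma \<open>laplacian_grad_inner\<close>), so that twice the
  integrand on the left is \<open>2 w \<Delta>v - \<nabla>(w\<^sup>2) \<bullet> \<phi>\<close>. As \<open>v\<close> has compact support in \<open>\<Omega>\<close>, Green's
  identity (\<open>integral_laplacian_symmetric\<close>) replaces the integral of \<open>2 w \<Delta>v\<close> by that of \<open>2 v \<Delta>w\<close>,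
  and the equation gives \<open>2 v \<Delta>w = - \<beta>\<^sub>\<epsilon>(u) \<nabla>u \<bullet> \<phi> = - \<nabla>(B\<^sub>\<epsilon>(u)) \<bullet> \<phi>\<close>. What is left is the
  integral of \<open>- \<nabla>(w\<^sup>2 + B\<^sub>\<epsilon>(u)) \<bullet> \<phi>\<close>, and the divergence theorem (\<open>integral_grad_inner\<close>) moves
  the derivative to \<open>\<phi>\<close>.

  All integrations by parts reduce to the fact that a partial derivative of a compactly supported
  continuously differentiable function has integral zero (\<open>integral_partial_deriv_eq_0\<close>), which
  follows from translation invariance of the Lebesgue measure. Every integrand contains \<open>\<phi>\<close>
  or one of its derivatives as a factor, so it vanishes off the compact support of \<open>\<phi>\<close>; this is
  why no boundary integrals appear.
\<close>

section \<open>Calculus of partial derivatives\<close>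

lemma partial_deriv_eqI:
  assumes "(f has_derivative f') (at x)"
  shows "partial_deriv b f x = f' b"
  unfolding partial_deriv_def using frechet_derivative_at[OF assms] by simp

lemma partial_deriv_cong_open:
  assumes "open S" "x \<in> S" "\<And>y. y \<in> S \<Longrightarrow> f y = g y"
  shows "partial_deriv b f x = partial_deriv b g x"
proof -
  have "(f has_derivative D) (at x) \<longleftrightarrow> (g has_derivative D) (at x)" for D
    using assms by (metis has_derivative_transform_within_open)
  then show ?thesis
    by (simp add: partial_deriv_def frechet_derivative_def)
qed

lemma partial_deriv_eq_0_off_closed:
  assumes "closed K" "\<And>y. y \<notin> K \<Longrightarrow> f y = 0" "x \<notin> K"
  shows "partial_deriv b f x = 0"
  using partial_deriv_cong_open[of "- K" x f "\<lambda>_. 0" b] assms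
  by (auto simp: partial_deriv_def open_Compl)

lemma partial_deriv_add:
  assumes "f differentiable (at x)" "g differentiable (at x)"
  shows "partial_deriv b (\<lambda>x. f x + g x) x = partial_deriv b f x + partial_deriv b g x"
  using assms has_derivative_add
  by (subst partial_deriv_eqI) (auto simp: frechet_derivative_works partial_deriv_def)

lemma partial_deriv_sum:
  assumes "finite I" "\<And>i. i \<in> I \<Longrightarrow> f i differentiable (at x)"
  shows "partial_deriv b (\<lambda>x. \<Sum>i\<in>I. f i x) x = (\<Sum>i\<in>I. partial_deriv b (f i) x)"
proof -
  have "((\<lambda>x. \<Sum>i\<in>I. f i x) has_derivative (\<lambda>h. \<Sum>i\<in>I. frechet_derivative (f i) (at x) h)) (at x)"
    using assms by (intro has_derivative_sum) (auto simp: frechet_derivative_works)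
  then show ?thesis
    by (subst partial_deriv_eqI) (auto simp: partial_deriv_def)
qed

lemma partial_deriv_mult:
  fixes f g :: "'a::euclidean_space \<Rightarrow> real"
  assumes "f differentiable (at x)" "g differentiable (at x)"
  shows "partial_deriv b (\<lambda>x. f x * g x) x = partial_deriv b f x * g x + f x * partial_deriv b g x"
proof -
  have "((\<lambda>x. f x * g x) has_derivative
      (\<lambda>h. f x * frechet_derivative g (at x) h + frechet_derivative f (at x) h * g x)) (at x)"
    using assms by (intro has_derivative_mult) (auto simp: frechet_derivative_works)
  from partial_deriv_eqI[OF this, of b] show ?thesis
    by (simp add: partial_deriv_def)
qed

lemma partial_deriv_bounded_linear:
  assumes "bounded_linear L" "f differentiable (at x)"
  shows "partial_deriv b (\<lambda>x. L (f x)) x = L (partial_deriv b f x)"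
proof -
  have "((\<lambda>x. L (f x)) has_derivative (\<lambda>h. L (frechet_derivative f (at x) h))) (at x)"
    using assms by (simp add: bounded_linear.has_derivative frechet_derivative_works)
  then show ?thesis
    by (subst partial_deriv_eqI) (auto simp: partial_deriv_def)
qed

lemma partial_deriv_compose_real:
  assumes "(F has_real_derivative d) (at (f x))" "f differentiable (at x)"
  shows "(\<lambda>x. F (f x)) differentiable (at x)"
    and "partial_deriv b (\<lambda>x. F (f x)) x = d * partial_deriv b f x"
proof -
  have "((\<lambda>x. F (f x)) has_derivative (\<lambda>h. d * frechet_derivative f (at x) h)) (at x)"
    using assms unfolding has_field_derivative_def frechet_derivative_works
    by (rule has_derivative_compose[rotated])
  then show "(\<lambda>x. F (f x)) differentiable (at x)"
    "partial_deriv b (\<lambda>x. F (f x)) x = d * partial_deriv b f x"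
    by (auto simp: partial_deriv_eqI differentiable_def) (auto simp: partial_deriv_def)
qed

lemma has_real_derivative_along_line:
  assumes "f differentiable (at (p + s *\<^sub>R a))"
  shows "((\<lambda>s. f (p + s *\<^sub>R a)) has_real_derivative partial_deriv a f (p + s *\<^sub>R a)) (at s)"
proof -
  let ?D = "frechet_derivative f (at (p + s *\<^sub>R a))"
  have D: "(f has_derivative ?D) (at (p + s *\<^sub>R a))"
    using assms by (simp add: frechet_derivative_works)
  then have lin: "linear ?D"
    using has_derivative_linear by blast
  have "((\<lambda>s. f (p + s *\<^sub>R a)) has_derivative (\<lambda>h. ?D (h *\<^sub>R a))) (at s)"
    by (rule has_derivative_compose[where f = "\<lambda>s. p + s *\<^sub>R a", OF _ D])
      (auto intro!: derivative_eq_intros)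
  then show ?thesis
    by (simp add: has_field_derivative_def partial_deriv_def linear_scale[OF lin] mult.commute[of _ "?D a"]
        mult_commute_abs)
qed

section \<open>The classes of continuously differentiable functions\<close>

text \<open>
  A partial derivative of order \<open>k\<close> of a function depends only on its values near a point, whence
  the regularity on an open set depends only on the values there. The closure properties under sums
  and products rest on this: the rule for the first derivative holds pointwise on \<open>S\<close> only, and the
  induction hypothesis applies to the right-hand side of that rule.
\<close>

lemma C_on_cong:
  assumes "open S" "C_on k S f" "\<And>x. x \<in> S \<Longrightarrow> f x = g x"
  shows "C_on k S g"
  using assms(2,3)
proof (induction k arbitrary: f g)
  case 0
  then show ?case by (simp cong: continuous_on_cong)
next
  case (Suc k)
  have "g differentiable (at x)" if "x \<in> S" for x
  proof -
    have "f differentiable (at x)" using Suc.prems(1) that by simp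
    then show ?thesis
      unfolding differentiable_def using Suc.prems(2) that \<open>open S\<close>
      by (metis has_derivative_transform_within_open)
  qed
  moreover have "C_on k S (partial_deriv b g)" if "b \<in> Basis" for b
  proof (rule Suc.IH)
    show "C_on k S (partial_deriv b f)" using Suc.prems(1) that by simp
    show "partial_deriv b f x = partial_deriv b g x" if "x \<in> S" for x
      using partial_deriv_cong_open[OF \<open>open S\<close> that] Suc.prems(2) by blast
  qed
  ultimately show ?case by simp
qed

lemma C_on_subset: "C_on k T f \<Longrightarrow> S \<subseteq> T \<Longrightarrow> C_on k S f"
  by (induction k arbitrary: f) (auto intro: continuous_on_subset)

lemma C_on_Suc_imp: "C_on (Suc k) S f \<Longrightarrow> C_on k S f"
proof (induction k arbitrary: f)
  case 0
  then have "\<And>x. x \<in> S \<Longrightarrow> isCont f x"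
    using differentiable_imp_continuous_within by auto
  then show ?case
    by (simp add: continuous_at_imp_continuous_on)
next
  case (Suc k)
  have "C_on k S (partial_deriv b f)" if "b \<in> Basis" for b
    using Suc.prems that by (intro Suc.IH) simp
  then show ?case
    using Suc.prems by simp
qed

lemma C_on_mono: "C_on k S f \<Longrightarrow> j \<le> k \<Longrightarrow> C_on j S f"
proof (induction k)
  case (Suc k)
  then show ?case using C_on_Suc_imp[of k S f] by (cases "j = Suc k") auto
qed simp

lemma C_on_imp_continuous_on: "C_on k S f \<Longrightarrow> continuous_on S f"
  using C_on_mono[of k S f 0] by simp

lemma C_on_imp_differentiable: "C_on k S f \<Longrightarrow> 0 < k \<Longrightarrow> x \<in> S \<Longrightarrow> f differentiable (at x)"
  by (cases k) auto

lemma C_on_partial_deriv: "C_on (Suc k) S f \<Longrightarrow> b \<in> Basis \<Longrightarrow> C_on k S (partial_deriv b f)"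
  by simp

lemma C_on_Un: "open S \<Longrightarrow> open T \<Longrightarrow> C_on k S f \<Longrightarrow> C_on k T f \<Longrightarrow> C_on k (S \<union> T) f"
  by (induction k arbitrary: f) (auto intro: continuous_on_open_Un)

lemma C_on_const:
  fixes S :: "'a::euclidean_space set"
  shows "C_on k S (\<lambda>_. c)"
proof (induction k arbitrary: c)
  case (Suc k)
  have "partial_deriv b (\<lambda>_. c) = (\<lambda>_. 0)" for b :: 'a
    by (auto simp: partial_deriv_def)
  then show ?case using Suc by simp
qed simp

lemma C_on_add: "open S \<Longrightarrow> C_on k S f \<Longrightarrow> C_on k S g \<Longrightarrow> C_on k S (\<lambda>x. f x + g x)"
proof (induction k arbitrary: f g)
  case (Suc k)
  have "C_on k S (partial_deriv b (\<lambda>x. f x + g x))" if "b \<in> Basis" for b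
  proof (rule C_on_cong)
    show "C_on k S (\<lambda>x. partial_deriv b f x + partial_deriv b g x)"
      using Suc.prems that by (intro Suc.IH) auto
  qed (use Suc.prems in \<open>auto simp: partial_deriv_add\<close>)
  then show ?case using Suc.prems by auto
qed (auto intro: continuous_on_add)

lemma C_on_sum:
  "finite I \<Longrightarrow> open S \<Longrightarrow> (\<And>i. i \<in> I \<Longrightarrow> C_on k S (f i)) \<Longrightarrow> C_on k S (\<lambda>x. \<Sum>i\<in>I. f i x)"
proof (induction I rule: finite_induct)
  case empty
  then show ?case by (simp add: C_on_const)
next
  case (insert i I)
  then have "C_on k S (\<lambda>x. f i x + (\<Sum>i\<in>I. f i x))"
    by (intro C_on_add) auto
  then show ?case using insert.hyps by simp
qed

lemma C_on_mult:
  fixes f g :: "'a::euclidean_space \<Rightarrow> real"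
  shows "open S \<Longrightarrow> C_on k S f \<Longrightarrow> C_on k S g \<Longrightarrow> C_on k S (\<lambda>x. f x * g x)"
proof (induction k arbitrary: f g)
  case (Suc k)
  have "C_on k S (partial_deriv b (\<lambda>x. f x * g x))" if "b \<in> Basis" for b
  proof (rule C_on_cong)
    show "C_on k S (\<lambda>x. partial_deriv b f x * g x + f x * partial_deriv b g x)"
      using Suc.prems that C_on_Suc_imp
      by (intro C_on_add Suc.IH) (auto simp del: C_on.simps intro: C_on_partial_deriv)
  qed (use Suc.prems in \<open>auto simp: partial_deriv_mult\<close>)
  then show ?case using Suc.prems by auto
qed (auto intro: continuous_on_mult)

lemma C_on_bounded_linear:
  assumes "bounded_linear L"
  shows "open S \<Longrightarrow> C_on k S f \<Longrightarrow> C_on k S (\<lambda>x. L (f x))"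
proof (induction k arbitrary: f)
  case 0
  then show ?case
    using assms bounded_linear.continuous_on by auto
next
  case (Suc k)
  have "(\<lambda>x. L (f x)) differentiable (at x)" if "x \<in> S" for x
    using Suc.prems that bounded_linear.has_derivative[OF assms] unfolding C_on.simps differentiable_def
    by blast
  moreover have "C_on k S (partial_deriv b (\<lambda>x. L (f x)))" if "b \<in> Basis" for b
  proof (rule C_on_cong)
    show "C_on k S (\<lambda>x. L (partial_deriv b f x))"
      using Suc.prems that by (intro Suc.IH) auto
  qed (use Suc.prems in \<open>auto simp: partial_deriv_bounded_linear[OF assms]\<close>)
  ultimately show ?case by simp
qed

text \<open>
  Fields such as \<open>\<nabla>u \<bullet> \<phi>\<close> are regular only inside \<open>\<Omega>\<close>, where \<open>u\<close> is, and vanish off the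
  compact support of \<open>\<phi>\<close>. Regularity is local, and the two open sets \<open>\<Omega>\<close> and \<open>- K\<close> cover the
  whole space, so that such a field is regular everywhere.
\<close>

lemma C_on_zero_extension:
  fixes f :: "'a::euclidean_space \<Rightarrow> 'b::real_normed_vector"
  assumes "open \<Omega>" "closed K" "K \<subseteq> \<Omega>" "C_on k \<Omega> f" "\<And>x. x \<notin> K \<Longrightarrow> f x = 0"
  shows "C_on k UNIV f"
proof -
  have "C_on k (- K) f"
  proof (rule C_on_cong)
    show "C_on k (- K) (\<lambda>_. 0 :: 'b)" by (rule C_on_const)
  qed (use assms in auto)
  then have "C_on k (\<Omega> \<union> - K) f"
    using assms by (intro C_on_Un) (auto simp: open_Compl)
  moreover have "\<Omega> \<union> - K = UNIV" using assms by auto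
  ultimately show ?thesis by simp
qed

section \<open>Symmetry of second derivatives\<close>

text \<open>
  The mean value theorem is applied twice, first in direction \<open>a\<close> to the increment of \<open>f\<close> in
  direction \<open>b\<close>, then in direction \<open>b\<close>. The second difference is symmetric in \<open>a\<close> and \<open>b\<close>, while the
  derivative on the right is taken in \<open>a\<close> first; this asymmetry gives the symmetry of the second
  derivatives.
\<close>

lemma second_difference_mvt:
  fixes f :: "'a::euclidean_space \<Rightarrow> real"
  assumes "0 < h"
    and S: "\<And>s t. 0 \<le> s \<Longrightarrow> s \<le> h \<Longrightarrow> 0 \<le> t \<Longrightarrow> t \<le> h \<Longrightarrow> x + s *\<^sub>R a + t *\<^sub>R b \<in> S"
    and f: "\<And>y. y \<in> S \<Longrightarrow> f differentiable (at y)"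
    and fa: "\<And>y. y \<in> S \<Longrightarrow> partial_deriv a f differentiable (at y)"
  obtains s t where "0 < s" "s < h" "0 < t" "t < h"
    "f (x + h *\<^sub>R a + h *\<^sub>R b) - f (x + h *\<^sub>R a) - f (x + h *\<^sub>R b) + f x
       = h\<^sup>2 * partial_deriv b (partial_deriv a f) (x + s *\<^sub>R a + t *\<^sub>R b)"
proof -
  define g where "g s = f ((x + h *\<^sub>R b) + s *\<^sub>R a) - f (x + s *\<^sub>R a)" for s
  have "(g has_real_derivative
      partial_deriv a f ((x + h *\<^sub>R b) + s *\<^sub>R a) - partial_deriv a f (x + s *\<^sub>R a)) (at s)"
    if "0 \<le> s" "s \<le> h" for s
    unfolding g_def using S[of s h] S[of s 0] that \<open>0 < h\<close>
    by (intro DERIV_diff has_real_derivative_along_line f) (auto simp: algebra_simps)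
  from MVT2[OF \<open>0 < h\<close> this] obtain s where s: "0 < s" "s < h"
    and gs: "g h - g 0 = (h - 0) * (partial_deriv a f ((x + h *\<^sub>R b) + s *\<^sub>R a) - partial_deriv a f (x + s *\<^sub>R a))"
    by blast
  have "((\<lambda>t. partial_deriv a f ((x + s *\<^sub>R a) + t *\<^sub>R b)) has_real_derivative
      partial_deriv b (partial_deriv a f) ((x + s *\<^sub>R a) + t *\<^sub>R b)) (at t)"
    if "0 \<le> t" "t \<le> h" for t
    using S[of s t] that s by (intro has_real_derivative_along_line fa) auto
  from MVT2[OF \<open>0 < h\<close> this] obtain t where t: "0 < t" "t < h"
    and "partial_deriv a f ((x + s *\<^sub>R a) + h *\<^sub>R b) - partial_deriv a f ((x + s *\<^sub>R a) + 0 *\<^sub>R b)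
      = (h - 0) * partial_deriv b (partial_deriv a f) ((x + s *\<^sub>R a) + t *\<^sub>R b)"
    by blast
  moreover have swap: "x + h *\<^sub>R b + r *\<^sub>R a = x + r *\<^sub>R a + h *\<^sub>R b" for r
    by simp
  ultimately have "g h - g 0 = h\<^sup>2 * partial_deriv b (partial_deriv a f) (x + s *\<^sub>R a + t *\<^sub>R b)"
    using gs unfolding swap by (simp add: power2_eq_square)
  moreover have "g h - g 0 = f (x + h *\<^sub>R a + h *\<^sub>R b) - f (x + h *\<^sub>R a) - f (x + h *\<^sub>R b) + f x"
    unfolding g_def swap by simp
  ultimately show thesis
    using s t that by metis
qed

text \<open>
  Each of the two mixed derivatives equals the second difference divided by \<open>h\<^sup>2\<close>, at some point near
  \<open>x\<close>; by continuity they agree at \<open>x\<close>.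
\<close>

lemma partial_deriv_commute:
  fixes f :: "'a::euclidean_space \<Rightarrow> real"
  assumes S: "open S" "C_on 2 S f" and x: "x \<in> S" and ab: "a \<in> Basis" "b \<in> Basis"
  shows "partial_deriv a (partial_deriv b f) x = partial_deriv b (partial_deriv a f) x"
    (is "?A x = ?B x")
proof (rule ccontr)
  assume "?A x \<noteq> ?B x"
  \<comment> \<open>Half the gap: the two values near \<open>x\<close> could coincide only if one of them moved that far.\<close>
  define e where "e = \<bar>?A x - ?B x\<bar> / 2"
  have e: "e > 0" using \<open>?A x \<noteq> ?B x\<close> by (simp add: e_def)
  have C1: "C_on 1 S (partial_deriv c f)" if "c \<in> Basis" for c
    using S(2) that by (simp add: numeral_2_eq_2)
  have "continuous_on S ?A" "continuous_on S ?B"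
    using C1 ab by auto
  then have "isCont ?A x" "isCont ?B x"
    using S x by (auto simp: continuous_on_eq_continuous_at)
  then have "\<forall>\<^sub>F y in nhds x. y \<in> S \<and> dist (?A y) (?A x) < e \<and> dist (?B y) (?B x) < e"
    using e S(1) x by (auto intro!: eventually_conj eventually_nhds_in_open tendstoD
        simp: isCont_def tendsto_at_iff_tendsto_nhds)
  then obtain d where "d > 0"
    and d: "\<And>y. dist y x < d \<Longrightarrow> y \<in> S \<and> dist (?A y) (?A x) < e \<and> dist (?B y) (?B x) < e"
    unfolding eventually_nhds_metric by blast
  \<comment> \<open>A step of length less than \<open>d / 2\<close> keeps both displacements together within \<open>d\<close>.\<close>
  define h where "h = d / 3"
  have h: "h > 0" using \<open>d > 0\<close> by (simp add: h_def)
  have near: "dist (x + s *\<^sub>R a' + t *\<^sub>R b') x < d"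
    if "0 \<le> s" "s \<le> h" "0 \<le> t" "t \<le> h" "a' \<in> Basis" "b' \<in> Basis" for s t a' b'
  proof -
    have "norm (s *\<^sub>R a' + t *\<^sub>R b') \<le> s + t"
      using norm_triangle_ineq[of "s *\<^sub>R a'" "t *\<^sub>R b'"] that by simp
    then show ?thesis
      using that \<open>d > 0\<close> by (simp add: dist_norm h_def add.assoc)
  qed
  have f: "f differentiable (at y)" if "y \<in> S" for y
    using C_on_imp_differentiable[OF S(2)] that by simp
  have fc: "partial_deriv c f differentiable (at y)" if "c \<in> Basis" "y \<in> S" for y c
    using C_on_imp_differentiable[OF C1] that by simp
  have mvt: "\<exists>y. dist y x < d \<and> f (x + h *\<^sub>R a' + h *\<^sub>R b') - f (x + h *\<^sub>R a') - f (x + h *\<^sub>R b') + f x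
      = h\<^sup>2 * partial_deriv b' (partial_deriv a' f) y"
    if a': "a' \<in> Basis" and b': "b' \<in> Basis" for a' b'
  proof (rule second_difference_mvt[OF h, of x a' b' S f])
    show "x + s *\<^sub>R a' + t *\<^sub>R b' \<in> S" if "0 \<le> s" "s \<le> h" "0 \<le> t" "t \<le> h" for s t
      using near[OF that a' b'] d by blast
  next
    fix s t
    assume st: "0 < s" "s < h" "0 < t" "t < h"
      and eq: "f (x + h *\<^sub>R a' + h *\<^sub>R b') - f (x + h *\<^sub>R a') - f (x + h *\<^sub>R b') + f x
        = h\<^sup>2 * partial_deriv b' (partial_deriv a' f) (x + s *\<^sub>R a' + t *\<^sub>R b')"
    have "dist (x + s *\<^sub>R a' + t *\<^sub>R b') x < d"
      using st by (intro near a' b') simp_all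
    with eq show ?thesis by blast
  qed (rule f fc[OF a'], assumption)+
  obtain y where y: "dist y x < d"
    "f (x + h *\<^sub>R a + h *\<^sub>R b) - f (x + h *\<^sub>R a) - f (x + h *\<^sub>R b) + f x = h\<^sup>2 * ?B y"
    using mvt[OF ab] by blast
  obtain z where z: "dist z x < d"
    "f (x + h *\<^sub>R b + h *\<^sub>R a) - f (x + h *\<^sub>R b) - f (x + h *\<^sub>R a) + f x = h\<^sup>2 * ?A z"
    using mvt[OF ab(2,1)] by blast
  have eq: "x + h *\<^sub>R b + h *\<^sub>R a = x + h *\<^sub>R a + h *\<^sub>R b" by (simp add: algebra_simps)
  have "h\<^sup>2 * ?A z = h\<^sup>2 * ?B y"
    using y(2) z(2) unfolding eq by linarith
  then have "?A z = ?B y"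
    using h by simp
  moreover have "dist (?A z) (?A x) < e" "dist (?B y) (?B x) < e"
    using d y(1) z(1) by blast+
  ultimately show False
    using dist_triangle_half_r[of "?A z" "?A x" "dist (?A x) (?B x)" "?B x"]
    by (simp add: e_def dist_real_def)
qed

section \<open>Integration by parts with compact support\<close>

lemma integrable_continuous_compact_support:
  fixes f :: "'a::euclidean_space \<Rightarrow> real"
  assumes "open \<Omega>" "compact K" "K \<subseteq> \<Omega>" "continuous_on \<Omega> f" "\<And>x. x \<notin> K \<Longrightarrow> f x = 0"
  shows "integrable lborel f"
proof -
  have "integrable lborel (\<lambda>x. indicator K x *\<^sub>R f x)"
    using assms by (intro borel_integrable_compact) (auto intro: continuous_on_subset)
  also have "(\<lambda>x. indicator K x *\<^sub>R f x) = f"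
    using assms(5) by (intro ext) (metis indicator_simps mult_cancel_right1 mult_zero_left scaleR_one real_scaleR_def)
  finally show ?thesis .
qed

lemma integral_translation:
  fixes f :: "'a::euclidean_space \<Rightarrow> real"
  assumes "f \<in> borel_measurable borel"
  shows "(LINT x|lborel. f (x + c)) = (LINT x|lborel. f x)"
proof -
  have "(LINT x|lborel. f x) = (LINT x|distr lborel borel ((+) c). f x)"
    by (simp add: lborel_distr_plus)
  also have "\<dots> = (LINT x|lborel. f (c + x))"
    using assms by (intro integral_distr) auto
  finally show ?thesis by (simp add: add.commute)
qed

text \<open>
  The difference quotients of \<open>f\<close> have integral zero because the Lebesgue measure is invariant under
  translations. They converge to the derivative pointwise, and by the mean value theorem they
  are bounded by any bound \<open>M\<close> of the derivative; as they vanish outside a common ball, dominated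
  convergence applies.
\<close>

lemma integral_partial_deriv_eq_0:
  fixes f :: "'a::euclidean_space \<Rightarrow> real"
  assumes f: "C_on 1 UNIV f" and K: "compact K" and supp: "\<And>x. x \<notin> K \<Longrightarrow> f x = 0"
    and b: "b \<in> Basis"
  shows "(LINT x|lborel. partial_deriv b f x) = 0"
proof -
  let ?f' = "partial_deriv b f"
  have diff: "f differentiable (at x)" for x
    using C_on_imp_differentiable[OF f] by simp
  have cf: "continuous_on UNIV f" and cf': "continuous_on UNIV ?f'"
    using C_on_imp_continuous_on[OF f] f b by auto
  have [measurable]: "f \<in> borel_measurable borel" "?f' \<in> borel_measurable borel"
    using cf cf' by (auto intro: borel_measurable_continuous_onI)
  have supp': "?f' x = 0" if "x \<notin> K" for x
    by (rule partial_deriv_eq_0_off_closed[OF compact_imp_closed[OF K] supp that])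
  obtain M where M: "M > 0" "\<And>x. x \<in> K \<Longrightarrow> \<bar>?f' x\<bar> \<le> M"
    using compact_imp_bounded[OF compact_continuous_image[OF continuous_on_subset[OF cf'] K]]
    unfolding bounded_pos by auto
  then have M': "\<bar>?f' x\<bar> \<le> M" for x
    using supp'[of x] by (cases "x \<in> K") auto
  obtain R where R: "\<And>x. x \<in> K \<Longrightarrow> norm x \<le> R"
    using compact_imp_bounded[OF K] unfolding bounded_iff by auto
  define h where "h n = 1 / real (Suc n)" for n
  have h: "0 < h n" "h n \<le> 1" for n by (auto simp: h_def)
  have h0: "h \<longlonglongrightarrow> 0"
    unfolding h_def using LIMSEQ_inverse_real_of_nat by (simp add: inverse_eq_divide)
  define q where "q n x = (f (x + h n *\<^sub>R b) - f x) / h n" for n x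
  have intf: "integrable lborel f"
    using K cf supp by (intro integrable_continuous_compact_support[of UNIV K]) auto
  have "integrable lborel (\<lambda>x. f (x + c))" for c
    using intf integrable_distr[of "(+) c" lborel borel f]
    by (simp add: lborel_distr_plus add.commute)
  then have q0: "(LINT x|lborel. q n x) = 0" for n
    using intf by (simp add: q_def integral_translation)
  \<comment> \<open>As \<open>h n \<le> 1\<close> and \<open>b\<close> is a unit vector, enlarging the radius by one covers the shifted supports.\<close>
  have "(\<lambda>n. LINT x|lborel. q n x) \<longlonglongrightarrow> (LINT x|lborel. ?f' x)"
  proof (rule integral_dominated_convergence[where w = "\<lambda>x. M * indicator (cball 0 (R + 1)) x"])
    have "emeasure lborel (cball (0::'a) (R + 1)) < \<infinity>"
      by (intro emeasure_bounded_finite) simp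
    then show "integrable lborel (\<lambda>x. M * indicator (cball (0::'a) (R + 1)) x :: real)"
      by (intro integrable_mult_right integrable_real_indicator) auto
    show "AE x in lborel. (\<lambda>n. q n x) \<longlonglongrightarrow> ?f' x"
    proof (rule AE_I2)
      fix x
      have "((\<lambda>s. f (x + s *\<^sub>R b)) has_real_derivative ?f' (x + 0 *\<^sub>R b)) (at 0)"
        by (rule has_real_derivative_along_line) (simp add: diff)
      then have "((\<lambda>s. (f (x + s *\<^sub>R b) - f x) / s) \<longlongrightarrow> ?f' x) (at 0)"
        by (simp add: has_field_derivative_iff)
      moreover have "filterlim h (at 0) sequentially"
        using h0 h(1) by (auto simp: filterlim_at less_imp_neq[OF h(1), symmetric])
      ultimately show "(\<lambda>n. q n x) \<longlonglongrightarrow> ?f' x"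
        unfolding q_def by (rule filterlim_compose)
    qed
    show "AE x in lborel. norm (q n x) \<le> M * indicator (cball 0 (R + 1)) x" for n
    proof (rule AE_I2)
      fix x
      have "\<exists>s>0. s < h n \<and> f (x + h n *\<^sub>R b) - f (x + 0 *\<^sub>R b) = (h n - 0) * ?f' (x + s *\<^sub>R b)"
        by (rule MVT2[OF h(1)]) (auto intro: has_real_derivative_along_line diff)
      then obtain s where "f (x + h n *\<^sub>R b) - f x = h n * ?f' (x + s *\<^sub>R b)"
        by auto
      then have bound: "norm (q n x) \<le> M"
        using M' h(1)[of n] by (simp add: q_def)
      show "norm (q n x) \<le> M * indicator (cball 0 (R + 1)) x"
      proof (cases "x \<in> cball 0 (R + 1)")
        case False
        have "norm x \<le> norm (x + h n *\<^sub>R b) + norm (h n *\<^sub>R b)"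
          using norm_triangle_ineq4[of "x + h n *\<^sub>R b" "h n *\<^sub>R b"] by simp
        also have "norm (h n *\<^sub>R b) \<le> 1"
          using h[of n] b by simp
        finally have "norm x > R" "norm (x + h n *\<^sub>R b) > R"
          using False by auto
        then have "f x = 0" "f (x + h n *\<^sub>R b) = 0"
          using supp R by (meson not_less)+
        then show ?thesis using M(1) by (simp add: q_def)
      qed (use bound in simp)
    qed
  qed (auto simp: q_def)
  then show ?thesis
    by (simp add: q0 LIMSEQ_const_iff)
qed

text \<open>
  Only \<open>f\<close> vanishes off \<open>K\<close>; outside \<open>\<Omega>\<close> the function \<open>g\<close> is arbitrary, and the values of
  its partial derivatives there are meaningless. They are always multiplied by zero, so the integrals
  can be taken over the whole space.
\<close>

lemma integral_by_parts_compact_support: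
  fixes f g :: "'a::euclidean_space \<Rightarrow> real"
  assumes \<Omega>: "open \<Omega>" and K: "compact K" "K \<subseteq> \<Omega>"
    and f: "C_on 1 \<Omega> f" and g: "C_on 1 \<Omega> g"
    and supp: "\<And>x. x \<notin> K \<Longrightarrow> f x = 0" and b: "b \<in> Basis"
  shows "integrable lborel (\<lambda>x. partial_deriv b f x * g x)"
    and "integrable lborel (\<lambda>x. f x * partial_deriv b g x)"
    and "(LINT x|lborel. partial_deriv b f x * g x) = - (LINT x|lborel. f x * partial_deriv b g x)"
proof -
  have supp': "partial_deriv b f x = 0" if "x \<notin> K" for x
    by (rule partial_deriv_eq_0_off_closed[OF compact_imp_closed[OF K(1)] supp that])
  have cont: "continuous_on \<Omega> f" "continuous_on \<Omega> g"
      "continuous_on \<Omega> (partial_deriv b f)" "continuous_on \<Omega> (partial_deriv b g)"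
    using C_on_imp_continuous_on[OF f] C_on_imp_continuous_on[OF g] f g b by auto
  show i1: "integrable lborel (\<lambda>x. partial_deriv b f x * g x)"
    using supp' cont
    by (intro integrable_continuous_compact_support[OF \<Omega> K] continuous_on_mult) auto
  show i2: "integrable lborel (\<lambda>x. f x * partial_deriv b g x)"
    using supp cont
    by (intro integrable_continuous_compact_support[OF \<Omega> K] continuous_on_mult) auto
  have "C_on 1 UNIV (\<lambda>x. f x * g x)"
    using \<Omega> K f g supp compact_imp_closed
    by (intro C_on_zero_extension[of \<Omega> K] C_on_mult) auto
  then have "(LINT x|lborel. partial_deriv b (\<lambda>x. f x * g x) x) = 0"
    by (rule integral_partial_deriv_eq_0[OF _ K(1) _ b]) (simp add: supp)
  moreover have "partial_deriv b (\<lambda>x. f x * g x) x = partial_deriv b f x * g x + f x * partial_deriv b g x" for x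
  proof (cases "x \<in> K")
    case True
    then have "x \<in> \<Omega>" using K by auto
    then show ?thesis
      using C_on_imp_differentiable[OF f] C_on_imp_differentiable[OF g]
      by (intro partial_deriv_mult) auto
  next
    case False
    have "partial_deriv b (\<lambda>x. f x * g x) x = 0"
      by (rule partial_deriv_eq_0_off_closed[OF compact_imp_closed[OF K(1)] _ False]) (simp add: supp)
    then show ?thesis using supp supp' False by simp
  qed
  ultimately show "(LINT x|lborel. partial_deriv b f x * g x) = - (LINT x|lborel. f x * partial_deriv b g x)"
    using i1 i2 by simp
qed

section \<open>Coordinate derivatives, Laplacian and gradient\<close>

abbreviation coord_deriv :: "'n::finite \<Rightarrow> (real^'n \<Rightarrow> 'b::real_normed_vector) \<Rightarrow> real^'n \<Rightarrow> 'b"  (\<open>\<partial>\<close>)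
  where "\<partial> i f \<equiv> partial_deriv (axis i 1) f"

lemma C_on_coord_deriv: "C_on (Suc k) S f \<Longrightarrow> C_on k S (\<partial> i f)"
  by (simp add: axis_in_Basis_iff)

lemma C_on_component:
  "open S \<Longrightarrow> C_on k S F \<Longrightarrow> C_on k S (\<lambda>x. F x $ i)"
  by (rule C_on_bounded_linear[OF bounded_linear_vec_nth])

lemma C_on_laplacian:
  assumes "open S" "C_on (Suc (Suc k)) S f"
  shows "C_on k S (laplacian f)"
proof -
  have "C_on k S (\<lambda>x. \<Sum>i\<in>UNIV. \<partial> i (\<partial> i f) x)"
    using assms by (intro C_on_sum C_on_coord_deriv) auto
  then show ?thesis
    by (simp add: laplacian_def[abs_def])
qed

lemma jacobian_nth:
  assumes "F differentiable (at x)"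
  shows "jacobian F (at x) $ i $ j = \<partial> j (\<lambda>z. F z $ i) x"
  using partial_deriv_bounded_linear[OF bounded_linear_vec_nth assms]
  by (simp add: jacobian_def matrix_def partial_deriv_def)

lemma grad_differentiable:
  assumes "\<And>i. \<partial> i f differentiable (at x)"
  shows "grad f differentiable (at x)"
  using assms
  by (subst differentiable_componentwise_within)
    (auto simp: Basis_vec_def inner_axis grad_def)

lemma laplacian_sum:
  assumes "open S" "x \<in> S" "finite I" "\<And>i. i \<in> I \<Longrightarrow> C_on 2 S (f i)"
  shows "laplacian (\<lambda>x. \<Sum>i\<in>I. f i x) x = (\<Sum>i\<in>I. laplacian (f i) x)"
proof -
  have f: "C_on (Suc (Suc 0)) S (f i)" if "i \<in> I" for i
    using assms(4)[OF that] by (simp add: numeral_2_eq_2)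
  have "\<partial> j (\<partial> j (\<lambda>x. \<Sum>i\<in>I. f i x)) x = \<partial> j (\<lambda>x. \<Sum>i\<in>I. \<partial> j (f i) x) x" for j
    by (rule partial_deriv_cong_open[OF assms(1,2)], rule partial_deriv_sum)
      (use assms(3) f in auto)
  also have "\<partial> j (\<lambda>x. \<Sum>i\<in>I. \<partial> j (f i) x) x = (\<Sum>i\<in>I. \<partial> j (\<partial> j (f i)) x)" for j
    by (rule partial_deriv_sum)
      (use assms(2,3) C_on_imp_differentiable[OF C_on_coord_deriv[OF f]] in auto)
  finally show ?thesis
    unfolding laplacian_def by (simp add: sum.swap[of _ UNIV I])
qed

lemma laplacian_mult:
  assumes S: "open S" "x \<in> S" and f: "C_on 2 S f" and g: "C_on 2 S g"
  shows "laplacian (\<lambda>x. f x * g x) x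
    = laplacian f x * g x + 2 * (\<Sum>i\<in>UNIV. \<partial> i f x * \<partial> i g x) + f x * laplacian g x"
proof -
  have d: "f differentiable (at y)" "g differentiable (at y)"
    "\<partial> i f differentiable (at y)" "\<partial> i g differentiable (at y)" if "y \<in> S" for y i
    using C_on_imp_differentiable[OF f _ that] C_on_imp_differentiable[OF g _ that]
      C_on_imp_differentiable[OF C_on_coord_deriv[of 1] _ that] f g
    by (auto simp: numeral_2_eq_2)
  have "\<partial> i (\<partial> i (\<lambda>x. f x * g x)) x = \<partial> i (\<lambda>x. \<partial> i f x * g x + f x * \<partial> i g x) x" for i
    by (rule partial_deriv_cong_open[OF S]) (simp add: partial_deriv_mult d)
  also have "\<dots> i = \<partial> i (\<partial> i f) x * g x + 2 * (\<partial> i f x * \<partial> i g x) + f x * \<partial> i (\<partial> i g) x" for i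
    using S(2) by (simp add: partial_deriv_add partial_deriv_mult d)
  finally show ?thesis
    by (simp add: laplacian_def sum.distrib sum_distrib_left sum_distrib_right)
qed

text \<open>
  Moving \<open>\<partial> j\<close> past both derivatives \<open>\<partial> i\<close> takes two exchanges: the inner one
  \<open>\<partial> i \<partial> j f = \<partial> j \<partial> i f\<close> holds on a neighbourhood of \<open>x\<close> and may be differentiated, the outer
  one is that of \<open>\<partial> i f\<close>.
\<close>

lemma laplacian_coord_deriv:
  assumes S: "open S" "x \<in> S" and f: "C_on 3 S f"
  shows "laplacian (\<partial> j f) x = \<partial> j (laplacian f) x"
proof -
  have f3: "C_on (Suc (Suc (Suc 0))) S f" using f by (simp add: numeral_3_eq_3)
  have f2: "C_on 2 S f" "C_on 2 S (\<partial> i f)" for i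
    using C_on_mono[OF f, of 2] C_on_coord_deriv[OF f3] by (simp_all only: numeral_2_eq_2)
  have "\<partial> i (\<partial> i (\<partial> j f)) x = \<partial> i (\<partial> j (\<partial> i f)) x" for i
    by (rule partial_deriv_cong_open[OF S], rule partial_deriv_commute[OF S(1) f2(1)])
      (auto simp: axis_in_Basis_iff)
  also have "\<partial> i (\<partial> j (\<partial> i f)) x = \<partial> j (\<partial> i (\<partial> i f)) x" for i
    by (rule partial_deriv_commute[OF S(1) f2(2) S(2)]) (auto simp: axis_in_Basis_iff)
  finally have "laplacian (\<partial> j f) x = (\<Sum>i\<in>UNIV. \<partial> j (\<partial> i (\<partial> i f)) x)"
    by (simp add: laplacian_def)
  also have "\<dots> = \<partial> j (\<lambda>x. \<Sum>i\<in>UNIV. \<partial> i (\<partial> i f) x) x"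
    using S(2) C_on_imp_differentiable[OF C_on_coord_deriv[OF C_on_coord_deriv[OF f3]]]
    by (intro partial_deriv_sum[symmetric]) auto
  finally show ?thesis
    by (simp add: laplacian_def[abs_def])
qed

lemma trace_hessian_jacobian:
  assumes u: "\<And>i. \<partial> i u differentiable (at x)" and \<phi>: "\<phi> differentiable (at x)"
  shows "trace (hessian u x ** jacobian \<phi> (at x))
    = (\<Sum>j\<in>UNIV. \<Sum>i\<in>UNIV. \<partial> i (\<partial> j u) x * \<partial> j (\<lambda>z. \<phi> z $ i) x)"
  using jacobian_nth[OF grad_differentiable[OF u]] jacobian_nth[OF \<phi>]
  by (simp add: trace_def matrix_matrix_mult_def hessian_def grad_def)

text \<open>
  This is the commutator computation behind the domain variation formula: the expression
  \<open>2 tr (D\<^sup>2u D\<phi>) + \<nabla>u \<bullet> \<Delta>\<phi>\<close> is what remains of \<open>\<Delta>(\<nabla>u \<bullet> \<phi>)\<close> after removing the term in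
  which the Laplacian falls on \<open>\<nabla>u\<close>.
\<close>

lemma laplacian_grad_inner:
  assumes S: "open S" "x \<in> S" and u: "C_on 3 S u" and \<phi>: "C_on 2 S \<phi>"
  shows "laplacian (\<lambda>z. grad u z \<bullet> \<phi> z) x
    = grad (laplacian u) x \<bullet> \<phi> x + 2 * trace (hessian u x ** jacobian \<phi> (at x))
      + grad u x \<bullet> vec_laplacian \<phi> x"
proof -
  have u2: "C_on 2 S u" using C_on_mono[OF u] by simp
  have du: "C_on 2 S (\<partial> j u)" for j
    using u by (intro C_on_coord_deriv) (simp only: numeral_3_eq_3 numeral_2_eq_2)
  have \<phi>j: "C_on 2 S (\<lambda>z. \<phi> z $ j)" for j
    by (rule C_on_component[OF S(1) \<phi>])
  have "laplacian (\<lambda>z. grad u z \<bullet> \<phi> z) x = laplacian (\<lambda>z. \<Sum>j\<in>UNIV. \<partial> j u z * \<phi> z $ j) x"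
    by (simp add: inner_vec_def grad_def)
  also have "\<dots> = (\<Sum>j\<in>UNIV. laplacian (\<lambda>z. \<partial> j u z * \<phi> z $ j) x)"
    by (rule laplacian_sum[OF S]) (auto intro!: C_on_mult S du \<phi>j)
  also have "\<dots> = (\<Sum>j\<in>UNIV. \<partial> j (laplacian u) x * \<phi> x $ j
      + 2 * (\<Sum>i\<in>UNIV. \<partial> j (\<partial> i u) x * \<partial> i (\<lambda>z. \<phi> z $ j) x)
      + \<partial> j u x * laplacian (\<lambda>z. \<phi> z $ j) x)"
    by (intro sum.cong refl)
      (simp add: laplacian_mult[OF S du \<phi>j] laplacian_coord_deriv[OF S u]
        partial_deriv_commute[OF S(1) u2 S(2)] axis_in_Basis_iff)
  also have "(\<Sum>j\<in>UNIV. \<Sum>i\<in>UNIV. \<partial> j (\<partial> i u) x * \<partial> i (\<lambda>z. \<phi> z $ j) x)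
      = trace (hessian u x ** jacobian \<phi> (at x))"
    using C_on_imp_differentiable[OF du] C_on_imp_differentiable[OF \<phi>] S(2)
    by (subst trace_hessian_jacobian) (auto intro: sum.swap)
  then have "(\<Sum>j\<in>UNIV. \<partial> j (laplacian u) x * \<phi> x $ j
      + 2 * (\<Sum>i\<in>UNIV. \<partial> j (\<partial> i u) x * \<partial> i (\<lambda>z. \<phi> z $ j) x)
      + \<partial> j u x * laplacian (\<lambda>z. \<phi> z $ j) x)
    = grad (laplacian u) x \<bullet> \<phi> x + 2 * trace (hessian u x ** jacobian \<phi> (at x))
      + grad u x \<bullet> vec_laplacian \<phi> x"
    by (simp add: sum.distrib grad_def inner_vec_def vec_laplacian_def flip: sum_distrib_left)
  finally show ?thesis .
qed

section \<open>Green's identity and the divergence theorem for compact support\<close>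

text \<open>
  Green's second identity without boundary terms: two integrations by parts, in each of which the
  compactly supported factor is \<open>\<partial> i f\<close> or \<open>f\<close>.
\<close>

lemma integral_laplacian_symmetric:
  fixes f g :: "real^'n \<Rightarrow> real"
  assumes \<Omega>: "open \<Omega>" and K: "compact K" "K \<subseteq> \<Omega>"
    and f: "C_on 2 \<Omega> f" and g: "C_on 2 \<Omega> g" and supp: "\<And>x. x \<notin> K \<Longrightarrow> f x = 0"
  shows "integrable lborel (\<lambda>x. laplacian f x * g x)"
    and "integrable lborel (\<lambda>x. f x * laplacian g x)"
    and "(LINT x|lborel. laplacian f x * g x) = (LINT x|lborel. f x * laplacian g x)"
proof -
  have f1: "C_on 1 \<Omega> f" "C_on 1 \<Omega> (\<partial> i f)" and g1: "C_on 1 \<Omega> g" "C_on 1 \<Omega> (\<partial> i g)" for i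
    using C_on_mono[OF f, of 1] C_on_mono[OF g, of 1] C_on_coord_deriv[of 1 \<Omega>] f g
    by (simp_all only: numeral_2_eq_2 One_nat_def)
  have supp': "\<partial> i f x = 0" if "x \<notin> K" for i x
    by (rule partial_deriv_eq_0_off_closed[OF compact_imp_closed[OF K(1)] supp that])
  have e: "axis i 1 \<in> (Basis :: (real^'n) set)" for i
    by (simp add: axis_in_Basis_iff)
  note one = integral_by_parts_compact_support[OF \<Omega> K f1(2) g1(1) supp' e]
  note two = integral_by_parts_compact_support[OF \<Omega> K f1(1) g1(2) supp e]
  have lf: "laplacian f x * g x = (\<Sum>i\<in>UNIV. \<partial> i (\<partial> i f) x * g x)" for x
    by (simp add: laplacian_def sum_distrib_right)
  have lg: "f x * laplacian g x = (\<Sum>i\<in>UNIV. f x * \<partial> i (\<partial> i g) x)" for x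
    by (simp add: laplacian_def sum_distrib_left)
  show "integrable lborel (\<lambda>x. laplacian f x * g x)"
    unfolding lf by (intro Bochner_Integration.integrable_sum one(1))
  show "integrable lborel (\<lambda>x. f x * laplacian g x)"
    unfolding lg by (intro Bochner_Integration.integrable_sum two(2))
  show "(LINT x|lborel. laplacian f x * g x) = (LINT x|lborel. f x * laplacian g x)"
    unfolding lf lg
    by (simp add: Bochner_Integration.integral_sum one(1) two(2) one(3) two(3))
qed

lemma integral_grad_inner:
  fixes h :: "real^'n \<Rightarrow> real" and \<phi> :: "real^'n \<Rightarrow> real^'n"
  assumes \<Omega>: "open \<Omega>" and K: "compact K" "K \<subseteq> \<Omega>"
    and h: "C_on 1 \<Omega> h" and \<phi>: "C_on 1 \<Omega> \<phi>" and supp: "\<And>x. x \<notin> K \<Longrightarrow> \<phi> x = 0"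
  shows "integrable lborel (\<lambda>x. grad h x \<bullet> \<phi> x)"
    and "(LINT x|lborel. grad h x \<bullet> \<phi> x) = - (LINT x|lborel. divergence \<phi> x * h x)"
proof -
  have e: "axis i 1 \<in> (Basis :: (real^'n) set)" for i
    by (simp add: axis_in_Basis_iff)
  have supp_i: "\<phi> x $ i = 0" if "x \<notin> K" for x i
    by (simp add: supp that)
  note parts = integral_by_parts_compact_support[OF \<Omega> K C_on_component[OF \<Omega> \<phi>] h supp_i e]
  have gr: "grad h x \<bullet> \<phi> x = (\<Sum>i\<in>UNIV. \<phi> x $ i * \<partial> i h x)" for x
    by (simp add: grad_def inner_vec_def mult.commute)
  have dv: "divergence \<phi> x * h x = (\<Sum>i\<in>UNIV. \<partial> i (\<lambda>z. \<phi> z $ i) x * h x)" for x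
    by (simp add: divergence_def sum_distrib_right)
  show "integrable lborel (\<lambda>x. grad h x \<bullet> \<phi> x)"
    unfolding gr by (intro Bochner_Integration.integrable_sum parts(2))
  show "(LINT x|lborel. grad h x \<bullet> \<phi> x) = - (LINT x|lborel. divergence \<phi> x * h x)"
    unfolding gr dv
    by (simp add: Bochner_Integration.integral_sum parts(1,2) parts(3) sum_negf)
qed

section \<open>The domain variation identity\<close>

lemma continuous_on_beta_eps:
  assumes "continuous_on UNIV \<beta>"
  shows "continuous_on S (beta_eps \<beta> \<epsilon>)"
proof -
  have "continuous_on S (\<lambda>t. \<beta> (t * inverse \<epsilon>))"
    by (rule continuous_on_compose2[OF assms]) (auto intro!: continuous_intros)
  then show ?thesis
    unfolding beta_eps_def divide_inverse by (intro continuous_on_mult_left)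
qed

lemma B_eps_has_real_derivative:
  assumes "continuous_on UNIV \<beta>"
  shows "(B_eps \<beta> \<epsilon> has_real_derivative beta_eps \<beta> \<epsilon> v) (at v)"
proof -
  \<comment> \<open>An interval with \<open>0\<close> and \<open>v\<close> in its interior, whichever sign \<open>v\<close> has.\<close>
  define a b where "a = min 0 v - 1" and "b = max 0 v + 1"
  have "((\<lambda>v. LBINT t=ereal 0..ereal v. beta_eps \<beta> \<epsilon> t) has_vector_derivative beta_eps \<beta> \<epsilon> v)
      (at v within {a..b})"
    using continuous_on_beta_eps[OF assms]
    by (intro interval_integral_FTC2) (auto simp: a_def b_def)
  moreover have "at v within {a..b} = at v"
    by (rule at_within_Icc_at) (auto simp: a_def b_def)
  ultimately show ?thesis
    by (simp add: B_eps_def[abs_def] has_real_derivative_iff_has_vector_derivative)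
qed

text \<open>
  With \<open>w = \<Delta>u\<close> this is the density on the right-hand side of the variation identity. Its gradient shows that both the
  nonlinear term \<open>\<beta>\<^sub>\<epsilon>(u) \<nabla>u\<close> and \<open>2w \<nabla>w\<close> are exact, which is why they can be turned into
  integrals against \<open>div \<phi>\<close>.
\<close>

lemma grad_square_plus_B_eps:
  fixes u w :: "real^'n \<Rightarrow> real"
  assumes \<Omega>: "open \<Omega>" and \<beta>: "continuous_on UNIV \<beta>" and u: "C_on 1 \<Omega> u" and w: "C_on 1 \<Omega> w"
  shows "C_on 1 \<Omega> (\<lambda>x. w x * w x + B_eps \<beta> \<epsilon> (u x))"
    and "x \<in> \<Omega> \<Longrightarrow> grad (\<lambda>x. w x * w x + B_eps \<beta> \<epsilon> (u x)) x
      = (2 * w x) *\<^sub>R grad w x + beta_eps \<beta> \<epsilon> (u x) *\<^sub>R grad u x"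
proof -
  have d: "u differentiable (at x)" "w differentiable (at x)" if "x \<in> \<Omega>" for x
    using C_on_imp_differentiable[OF u] C_on_imp_differentiable[OF w] that by auto
  note B = partial_deriv_compose_real[OF B_eps_has_real_derivative[OF \<beta>] d(1)]
  have "continuous_on \<Omega> (\<lambda>x. beta_eps \<beta> \<epsilon> (u x))"
    by (rule continuous_on_compose2[OF continuous_on_beta_eps[OF \<beta>] C_on_imp_continuous_on[OF u]]) auto
  then have "continuous_on \<Omega> (\<lambda>x. beta_eps \<beta> \<epsilon> (u x) * partial_deriv b u x)" if "b \<in> Basis" for b
    using u that by (intro continuous_on_mult) auto
  then have "C_on 1 \<Omega> (\<lambda>x. B_eps \<beta> \<epsilon> (u x))"
    using B by (auto simp: cong: continuous_on_cong)
  then show "C_on 1 \<Omega> (\<lambda>x. w x * w x + B_eps \<beta> \<epsilon> (u x))"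
    by (intro C_on_add C_on_mult \<Omega> w)
  show "grad (\<lambda>x. w x * w x + B_eps \<beta> \<epsilon> (u x)) x
      = (2 * w x) *\<^sub>R grad w x + beta_eps \<beta> \<epsilon> (u x) *\<^sub>R grad u x" if "x \<in> \<Omega>"
    using that d B
    by (simp add: vec_eq_iff grad_def partial_deriv_add partial_deriv_mult differentiable_mult)
qed

theorem lemma1p2:
  fixes \<Omega> :: "(real^'n) set"
    and \<beta> :: "real \<Rightarrow> real"
    and \<epsilon> :: real
    and u :: "real^'n \<Rightarrow> real"
    and \<phi> :: "real^'n \<Rightarrow> real^'n"
  assumes "smooth_bounded_domain \<Omega>"
    and "smooth_on UNIV \<beta>"
    and "\<And>t. \<beta> t \<ge> 0"
    and "closure {t. \<beta> t \<noteq> 0} \<subseteq> {0..1}"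
    and "(LINT t|lborel. \<beta> t) = 1"
    and "0 < \<epsilon>" and "\<epsilon> \<le> 1"
    and "bounded_solution \<beta> \<epsilon> \<Omega> u"
    and "test_field \<Omega> \<phi>"
  shows "2 * (LINT y:\<Omega>|lborel.
            (2 * trace (hessian u y ** jacobian \<phi> (at y)) + grad u y \<bullet> vec_laplacian \<phi> y)
              * laplacian u y)
       = (LINT y:\<Omega>|lborel.
            divergence \<phi> y * (\<bar>laplacian u y\<bar>\<^sup>2 + B_eps \<beta> \<epsilon> (u y)))"
proof -
  define K where "K = closure {x. \<phi> x \<noteq> 0}"
  define w where "w = laplacian u"
  define v where "v x = grad u x \<bullet> \<phi> x" for x
  define h where "h x = w x * w x + B_eps \<beta> \<epsilon> (u x)" for x
  have \<Omega>: "open \<Omega>"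
    using assms(1) by (simp add: smooth_bounded_domain_def)
  have K: "compact K" "K \<subseteq> \<Omega>"
    using assms(9) by (simp_all add: test_field_def K_def)
  have supp: "\<phi> x = 0" if "x \<notin> K" for x
    using that closure_subset[of "{x. \<phi> x \<noteq> 0}"] by (auto simp: K_def)
  have \<phi>: "C_on k \<Omega> \<phi>" for k
    by (rule C_on_subset[of k UNIV]) (use assms(9) in \<open>simp_all add: test_field_def smooth_on_def\<close>)
  have u4: "C_on 4 \<Omega> u" and eq: "\<And>x. x \<in> \<Omega> \<Longrightarrow> 2 * laplacian w x = - beta_eps \<beta> \<epsilon> (u x)"
    using assms(8) by (simp_all only: bounded_solution_def w_def)
  have u: "C_on 3 \<Omega> u" "C_on 1 \<Omega> u"
    using C_on_mono[OF u4, of 3] C_on_mono[OF u4, of 1] by simp_all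
  have w: "C_on 2 \<Omega> w"
    using u4 C_on_laplacian[OF \<Omega>, of 2 u] by (simp only: w_def Suc_numeral semiring_norm)
  have w1: "C_on 1 \<Omega> w"
    using C_on_mono[OF w, of 1] by simp
  have du: "C_on 2 \<Omega> (\<partial> i u)" for i
    using u(1) C_on_coord_deriv[of 2 \<Omega> u i] by (simp only: Suc_numeral semiring_norm)
  have v: "C_on 2 \<Omega> v"
    unfolding v_def inner_vec_def grad_def
    by (auto intro!: C_on_sum C_on_mult \<Omega> du C_on_component \<phi>)
  have suppv: "v x = 0" if "x \<notin> K" for x
    by (simp add: v_def supp that)
  have \<beta>: "continuous_on UNIV \<beta>"
    using assms(2) C_on_imp_continuous_on by (auto simp: smooth_on_def)
  have h: "C_on 1 \<Omega> h"
    unfolding h_def by (rule grad_square_plus_B_eps[OF \<Omega> \<beta> u(2) w1])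
  have ww: "C_on 1 \<Omega> (\<lambda>x. w x * w x)"
    by (intro C_on_mult \<Omega> w1)
  note green = integral_laplacian_symmetric[OF \<Omega> K v w suppv]
  note div_h = integral_grad_inner[OF \<Omega> K h \<phi> supp]
  note div_ww = integral_grad_inner[OF \<Omega> K ww \<phi> supp]

  have outside: "v x = 0" "laplacian v x = 0" "divergence \<phi> x = 0" "\<phi> x = 0" if "x \<notin> \<Omega>" for x
  proof -
    have x: "x \<notin> K" using that K by auto
    note off = partial_deriv_eq_0_off_closed[OF compact_imp_closed[OF K(1)]]
    show "v x = 0" "\<phi> x = 0" using x suppv supp by auto
    show "laplacian v x = 0"
      unfolding laplacian_def by (intro sum.neutral ballI off suppv x)
    show "divergence \<phi> x = 0"
      unfolding divergence_def by (intro sum.neutral ballI off) (simp_all add: supp x)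
  qed
  have grad_ww: "grad (\<lambda>x. w x * w x) x = (2 * w x) *\<^sub>R grad w x" if "x \<in> \<Omega>" for x
    using C_on_imp_differentiable[OF w _ that]
    by (simp add: grad_def vec_eq_iff partial_deriv_mult)

  \<comment> \<open>The left integrand in terms of \<open>\<Delta>v\<close>, from the product rule for \<open>\<Delta>(\<nabla>u \<bullet> \<phi>)\<close>.\<close>
  have lhs: "2 * (indicator \<Omega> y *\<^sub>R ((2 * trace (hessian u y ** jacobian \<phi> (at y))
      + grad u y \<bullet> vec_laplacian \<phi> y) * w y))
    = 2 * (laplacian v y * w y) - grad (\<lambda>x. w x * w x) y \<bullet> \<phi> y" for y
  proof (cases "y \<in> \<Omega>")
    case True
    then show ?thesis
      using laplacian_grad_inner[OF \<Omega> True u(1) \<phi>[of 2], folded w_def]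
      by (simp add: v_def[abs_def] grad_ww algebra_simps)
  qed (simp add: outside)
  \<comment> \<open>Once the Laplacian has been moved to \<open>w\<close>, the equation replaces \<open>2 \<Delta>w\<close> by \<open>- \<beta>\<^sub>\<epsilon>(u)\<close>.\<close>
  have pde: "2 * (v y * laplacian w y) - grad (\<lambda>x. w x * w x) y \<bullet> \<phi> y = - (grad h y \<bullet> \<phi> y)" for y
  proof (cases "y \<in> \<Omega>")
    case True
    have "2 * (v y * laplacian w y) = - beta_eps \<beta> \<epsilon> (u y) * v y"
      using eq[OF True] by (metis mult.left_commute mult.commute)
    then show ?thesis
      unfolding h_def
      by (simp add: grad_square_plus_B_eps(2)[OF \<Omega> \<beta> u(2) w1 True] grad_ww[OF True]
          v_def inner_add_left)
  qed (simp add: outside)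

  have "2 * (LINT y:\<Omega>|lborel. (2 * trace (hessian u y ** jacobian \<phi> (at y))
      + grad u y \<bullet> vec_laplacian \<phi> y) * w y)
    = (LINT y|lborel. 2 * (laplacian v y * w y) - grad (\<lambda>x. w x * w x) y \<bullet> \<phi> y)"
    unfolding set_lebesgue_integral_def lhs[symmetric] by simp
  also have "\<dots> = (LINT y|lborel. 2 * (v y * laplacian w y) - grad (\<lambda>x. w x * w x) y \<bullet> \<phi> y)"
    using green div_ww by simp
  also have "\<dots> = (LINT y|lborel. divergence \<phi> y * h y)"
    unfolding pde using div_h by simp
  also have "\<dots> = (LINT y:\<Omega>|lborel. divergence \<phi> y * (\<bar>w y\<bar>\<^sup>2 + B_eps \<beta> \<epsilon> (u y)))"
    unfolding set_lebesgue_integral_def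
    by (intro Bochner_Integration.integral_cong refl)
      (auto simp: indicator_def outside h_def power2_eq_square)
  finally show ?thesis
    by (simp add: w_def)
qed

end
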